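(* Let $a,b\in\mathbb{R}$, let $f,g$ be smooth real functions of $y$, and consider the Type-I twisted surface in $E_1^3$ $$\Omega(x,y)=\big((a+f\cosh(bx)+g\sinh(bx))\cos x,\ (a+f\cosh(bx)+g\sinh(bx))\sin x,\ f\sinh(bx)+g\cosh(bx)\big),$$ where $f=f(y)$, $g=g(y)$, $f'=df/dy$, $g'=dg/dy$. Write $$G=2a^{2}+(1-2b^{2}+\cosh(2bx))f^{2}+(2b^{2}-1+\cosh(2bx))g^{2}+4ag\sinh(bx)+4f\cosh(bx)(a+g\sinh(bx)).$$ Let $p,q,r\in\{1,-1\}$ be the signs of the causal types of the surface, the loxodrome and the meridian respectively ($1$ for spacelike, $-1$ for timelike). Then the differential equations of loxodromes on this surface which cut all meridians at a constant angle $\theta$ are given by $$\frac{dy}{dx}=\frac{-pqr\,b(f'g-fg')A^{2}\,G\ \mp\ \frac{B}{2}\,G\,\sqrt{\frac{p\left(2b^{2}(f'g-fg')^{2}-(f'^{2}-g'^{2})\right)}{2}\,G}}{\Big(2b^{2}(f'g-fg')^{2}-qr\,(f'^{2}-g'^{2})(-pA^{2}+qr)\Big)\,G},$$ where $$(A,B)=\begin{cases}(\sin\theta,\ \sin(2\theta)) & \text{if } p=1,\\ (\sinh\theta,\ \sinh(2\theta)) & \text{if } p=-1 \text{ and } qr=1,\\ (\cosh\theta,\ \sinh(2\theta)) & \text{if } p=-1\text{ and } qr=-1.\end{cases}$$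
   Context: $E_1^3$ is $\mathbb{R}^3$ with the metric $\langle u,v\rangle=u_1v_1+u_2v_2-u_3v_3$, and $\|u\|=\sqrt{|\langle u,u\rangle|}$. A vector $u$ is spacelike if $\langle u,u\rangle>0$ or $u=0$, and timelike if $\langle u,u\rangle<0$. A curve is spacelike (timelike) if its tangent vectors are everywhere spacelike (timelike). A surface $\Omega(x,y)$ with $g_{11}=\langle\Omega_x,\Omega_x\rangle$, $g_{12}=\langle\Omega_x,\Omega_y\rangle$, $g_{22}=\langle\Omega_y,\Omega_y\rangle$ is spacelike (timelike) if $g_{11}g_{22}-g_{12}^2>0$ (respectively $<0$). Meridians are the curves $y=\text{constant}$, with tangent $\Omega_x$. A loxodrome is a curve on the surface that cuts all meridians at a constant angle $\theta$. With $T=\Omega_x\,dx+\Omega_y\,dy$ denoting the tangent direction of the loxodrome, the Lorentzian angle $\theta$ is understood as follows: - surface, loxodrome and meridian all spacelike: $\theta\in[0,\pi]$ and $\langle\Omega_x,T\rangle=\|\Omega_x\|\|T\|\cos\theta$; - timelike surface, loxodrome and meridian spacelike: $\theta>0$ and $\langle\Omega_x,T\rangle=\varepsilon\|\Omega_x\|\|T\|\cosh\theta$ with $\varepsilon=\pm1$; - timelike surface, one of loxodrome and meridian spacelike and the other timelike: $\theta\ge0$ and $\langle\Omega_x,T\rangle=\varepsilon\|\Omega_x\|\|T\|\sinh\theta$ with $\varepsilon=\pm1$; - timelike surface, loxodrome and meridian timelike: $\theta>0$ and $\langle\Omega_x,T\rangle=-\|\Omega_x\|\|T\|\cosh\thet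a$.
   Formalization: The printed equation is false; with W=f'g-fg', E=f'^2-g'^2 the radicand is corrected to -p(2b^2W^2-EG)/2 and the denominator to 2b^2W^2-qrE(-pA^2+qr)G, so G multiplies only the E term; the denominator is assumed nonzero. *)

theory Defs
  imports "HOL-Analysis.Analysis"
begin

text \<open>Minkowski 3-space \<open>E\<^sub>1\<^sup>3\<close>.\<close>

definition mink :: "real ^ 3 \<Rightarrow> real ^ 3 \<Rightarrow> real" where
  "mink u v = u $ 1 * v $ 1 + u $ 2 * v $ 2 - u $ 3 * v $ 3"

definition mink_norm :: "real ^ 3 \<Rightarrow> real" where
  "mink_norm u = sqrt \<bar>mink u u\<bar>"

definition spacelike :: "real ^ 3 \<Rightarrow> bool" where
  "spacelike u \<longleftrightarrow> mink u u > 0 \<or> u = 0"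

definition timelike :: "real ^ 3 \<Rightarrow> bool" where
  "timelike u \<longleftrightarrow> mink u u < 0"

definition causal_sign :: "real ^ 3 \<Rightarrow> real \<Rightarrow> bool" where
  "causal_sign u s \<longleftrightarrow> (s = 1 \<and> spacelike u) \<or> (s = -1 \<and> timelike u)"


text \<open>A parametrized surface is a map \<open>\<Omega>\<close> of two real variables, used on a parameter domain \<open>D\<close>.\<close>

definition surf_dx :: "(real \<Rightarrow> real \<Rightarrow> real ^ 3) \<Rightarrow> real \<Rightarrow> real \<Rightarrow> real ^ 3" where
  "surf_dx \<Omega> x y = vector_derivative (\<lambda>s. \<Omega> s y) (at x)"

definition surf_dy :: "(real \<Rightarrow> real \<Rightarrow> real ^ 3) \<Rightarrow> real \<Rightarrow> real \<Rightarrow> real ^ 3" where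
  "surf_dy \<Omega> x y = vector_derivative (\<lambda>s. \<Omega> x s) (at y)"

definition g11 :: "(real \<Rightarrow> real \<Rightarrow> real ^ 3) \<Rightarrow> real \<Rightarrow> real \<Rightarrow> real" where
  "g11 \<Omega> x y = mink (surf_dx \<Omega> x y) (surf_dx \<Omega> x y)"

definition g12 :: "(real \<Rightarrow> real \<Rightarrow> real ^ 3) \<Rightarrow> real \<Rightarrow> real \<Rightarrow> real" where
  "g12 \<Omega> x y = mink (surf_dx \<Omega> x y) (surf_dy \<Omega> x y)"

definition g22 :: "(real \<Rightarrow> real \<Rightarrow> real ^ 3) \<Rightarrow> real \<Rightarrow> real \<Rightarrow> real" where
  "g22 \<Omega> x y = mink (surf_dy \<Omega> x y) (surf_dy \<Omega> x y)"

definition spacelike_surface :: "(real \<Rightarrow> real \<Rightarrow> real ^ 3) \<Rightarrow> (real \<times> real) set \<Rightarrow> bool" where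
  "spacelike_surface \<Omega> D \<longleftrightarrow> (\<forall>(x, y)\<in>D. g11 \<Omega> x y * g22 \<Omega> x y - (g12 \<Omega> x y)\<^sup>2 > 0)"

definition timelike_surface :: "(real \<Rightarrow> real \<Rightarrow> real ^ 3) \<Rightarrow> (real \<times> real) set \<Rightarrow> bool" where
  "timelike_surface \<Omega> D \<longleftrightarrow> (\<forall>(x, y)\<in>D. g11 \<Omega> x y * g22 \<Omega> x y - (g12 \<Omega> x y)\<^sup>2 < 0)"

definition surface_sign :: "(real \<Rightarrow> real \<Rightarrow> real ^ 3) \<Rightarrow> (real \<times> real) set \<Rightarrow> real \<Rightarrow> bool" where
  "surface_sign \<Omega> D p \<longleftrightarrow>
     (p = 1 \<and> spacelike_surface \<Omega> D) \<or> (p = -1 \<and> timelike_surface \<Omega> D)"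

definition meridian_sign :: "(real \<Rightarrow> real \<Rightarrow> real ^ 3) \<Rightarrow> (real \<times> real) set \<Rightarrow> real \<Rightarrow> bool" where
  "meridian_sign \<Omega> D r \<longleftrightarrow> (\<forall>(x, y)\<in>D. causal_sign (surf_dx \<Omega> x y) r)"


text \<open>A curve on the surface is given by its coordinate functions \<open>X\<close>, \<open>Y\<close> on an interval \<open>J\<close>;
  \<open>curve_tangent\<close> is \<open>\<Omega>\<^sub>x dx + \<Omega>\<^sub>y dy\<close> along it.\<close>

definition curve_tangent ::
    "(real \<Rightarrow> real \<Rightarrow> real ^ 3) \<Rightarrow> (real \<Rightarrow> real) \<Rightarrow> (real \<Rightarrow> real) \<Rightarrow> real \<Rightarrow> real ^ 3" where
  "curve_tangent \<Omega> X Y t =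
     deriv X t *\<^sub>R surf_dx \<Omega> (X t) (Y t) + deriv Y t *\<^sub>R surf_dy \<Omega> (X t) (Y t)"

definition curve_sign ::
    "(real \<Rightarrow> real \<Rightarrow> real ^ 3) \<Rightarrow> (real \<Rightarrow> real) \<Rightarrow> (real \<Rightarrow> real) \<Rightarrow> real set \<Rightarrow> real \<Rightarrow> bool" where
  "curve_sign \<Omega> X Y J q \<longleftrightarrow> (\<forall>t\<in>J. causal_sign (curve_tangent \<Omega> X Y t) q)"

definition admissible_angle :: "real \<Rightarrow> real \<Rightarrow> real \<Rightarrow> real \<Rightarrow> bool" where
  "admissible_angle p q r \<theta> \<longleftrightarrow>
     (if p = 1 then 0 \<le> \<theta> \<and> \<theta> \<le> pi else if q = r then 0 < \<theta> else 0 \<le> \<theta>)"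

text \<open>\<open>lorentz_angle p q r m v \<theta>\<close>: the meridian tangent \<open>m\<close> (of causal sign \<open>r\<close>) and the curve
  tangent \<open>v\<close> (of causal sign \<open>q\<close>) make the angle \<open>\<theta>\<close> on a surface of causal sign \<open>p\<close>.\<close>

definition lorentz_angle :: "real \<Rightarrow> real \<Rightarrow> real \<Rightarrow> real ^ 3 \<Rightarrow> real ^ 3 \<Rightarrow> real \<Rightarrow> bool" where
  "lorentz_angle p q r m v \<theta> \<longleftrightarrow> admissible_angle p q r \<theta> \<and>
     ((p = 1 \<and> q = 1 \<and> r = 1 \<and> mink m v = mink_norm m * mink_norm v * cos \<theta>) \<or>
      (p = -1 \<and> q = 1 \<and> r = 1 \<and>
         (\<exists>\<epsilon>\<in>{1, -1}. mink m v = \<epsilon> * mink_norm m * mink_norm v * cosh \<theta>)) \<or>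
      (p = -1 \<and> ((q = 1 \<and> r = -1) \<or> (q = -1 \<and> r = 1)) \<and>
         (\<exists>\<epsilon>\<in>{1, -1}. mink m v = \<epsilon> * mink_norm m * mink_norm v * sinh \<theta>)) \<or>
      (p = -1 \<and> q = -1 \<and> r = -1 \<and> mink m v = - mink_norm m * mink_norm v * cosh \<theta>))"

definition loxodrome ::
    "(real \<Rightarrow> real \<Rightarrow> real ^ 3) \<Rightarrow> real \<Rightarrow> real \<Rightarrow> real \<Rightarrow>
     (real \<Rightarrow> real) \<Rightarrow> (real \<Rightarrow> real) \<Rightarrow> real set \<Rightarrow> real \<Rightarrow> bool" where
  "loxodrome \<Omega> p q r X Y J \<theta> \<longleftrightarrow>
     (\<forall>t\<in>J. lorentz_angle p q r (surf_dx \<Omega> (X t) (Y t)) (curve_tangent \<Omega> X Y t) \<theta>)"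


definition smooth_fun_on :: "(real \<Rightarrow> real) \<Rightarrow> real set \<Rightarrow> bool" where
  "smooth_fun_on f I \<longleftrightarrow> (\<forall>n. \<forall>y\<in>I. (deriv ^^ n) f field_differentiable at y)"

definition twisted_surface ::
    "real \<Rightarrow> real \<Rightarrow> (real \<Rightarrow> real) \<Rightarrow> (real \<Rightarrow> real) \<Rightarrow> real \<Rightarrow> real \<Rightarrow> real ^ 3" where
  "twisted_surface a b f g x y = vector
     [(a + f y * cosh (b * x) + g y * sinh (b * x)) * cos x,
      (a + f y * cosh (b * x) + g y * sinh (b * x)) * sin x,
      f y * sinh (b * x) + g y * cosh (b * x)]"

text \<open>For the twisted surface \<open>twisted_G\<close> equals \<open>2 g\<^sub>1\<^sub>1\<close>, \<open>b * twisted_W\<close> equals \<open>g\<^sub>1\<^sub>2\<close> and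
  \<open>twisted_E\<close> equals \<open>g\<^sub>2\<^sub>2\<close>.\<close>

definition twisted_G ::
    "real \<Rightarrow> real \<Rightarrow> (real \<Rightarrow> real) \<Rightarrow> (real \<Rightarrow> real) \<Rightarrow> real \<Rightarrow> real \<Rightarrow> real" where
  "twisted_G a b f g x y =
     2 * a\<^sup>2 + (1 - 2 * b\<^sup>2 + cosh (2 * b * x)) * (f y)\<^sup>2
     + (2 * b\<^sup>2 - 1 + cosh (2 * b * x)) * (g y)\<^sup>2
     + 4 * a * g y * sinh (b * x) + 4 * f y * cosh (b * x) * (a + g y * sinh (b * x))"

definition twisted_W :: "(real \<Rightarrow> real) \<Rightarrow> (real \<Rightarrow> real) \<Rightarrow> real \<Rightarrow> real" where
  "twisted_W f g y = deriv f y * g y - f y * deriv g y"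

definition twisted_E :: "(real \<Rightarrow> real) \<Rightarrow> (real \<Rightarrow> real) \<Rightarrow> real \<Rightarrow> real" where
  "twisted_E f g y = (deriv f y)\<^sup>2 - (deriv g y)\<^sup>2"

definition lox_A :: "real \<Rightarrow> real \<Rightarrow> real \<Rightarrow> real \<Rightarrow> real" where
  "lox_A p q r \<theta> = (if p = 1 then sin \<theta> else if q * r = 1 then sinh \<theta> else cosh \<theta>)"

definition lox_B :: "real \<Rightarrow> real \<Rightarrow> real \<Rightarrow> real \<Rightarrow> real" where
  "lox_B p q r \<theta> = (if p = 1 then sin (2 * \<theta>) else sinh (2 * \<theta>))"

text \<open>In the numerator \<open>\<sigma>\<close> is the choice of sign in front of the root. The radicand
  \<open>- p (2 b\<^sup>2 W\<^sup>2 - E G) / 2\<close> equals \<open>p (g\<^sub>1\<^sub>1 g\<^sub>2\<^sub>2 - g\<^sub>1\<^sub>2\<^sup>2)\<close>, which is positive on a surface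
  of causal sign \<open>p\<close>. In the source formula the radicand is \<open>p (2 b\<^sup>2 W\<^sup>2 - E) G / 2\<close> and the
  denominator is \<open>(2 b\<^sup>2 W\<^sup>2 - q r E (- p A\<^sup>2 + q r)) G\<close>. These are misprints: \<open>G\<close> belongs to the
  term containing \<open>E\<close> only, and the radicand has the opposite sign.\<close>

definition lox_num ::
    "real \<Rightarrow> real \<Rightarrow> (real \<Rightarrow> real) \<Rightarrow> (real \<Rightarrow> real) \<Rightarrow> real \<Rightarrow> real \<Rightarrow> real \<Rightarrow> real \<Rightarrow>
     real \<Rightarrow> real \<Rightarrow> real \<Rightarrow> real" where
  "lox_num a b f g p q r \<theta> \<sigma> x y =
     - p * q * r * b * twisted_W f g y * (lox_A p q r \<theta>)\<^sup>2 * twisted_G a b f g x y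
     + \<sigma> * (lox_B p q r \<theta> / 2) * twisted_G a b f g x y
       * sqrt (- p * (2 * b\<^sup>2 * (twisted_W f g y)\<^sup>2 - twisted_E f g y * twisted_G a b f g x y) / 2)"

definition lox_den ::
    "real \<Rightarrow> real \<Rightarrow> (real \<Rightarrow> real) \<Rightarrow> (real \<Rightarrow> real) \<Rightarrow> real \<Rightarrow> real \<Rightarrow> real \<Rightarrow> real \<Rightarrow>
     real \<Rightarrow> real \<Rightarrow> real" where
  "lox_den a b f g p q r \<theta> x y =
     2 * b\<^sup>2 * (twisted_W f g y)\<^sup>2
     - q * r * twisted_E f g y * (- p * (lox_A p q r \<theta>)\<^sup>2 + q * r) * twisted_G a b f g x y"

end

theory Submission
  imports Defs
begin

text \<open>
  Write \<open>e, F, H\<close> for the coefficients of the first fundamental form, \<open>\<Delta> = e H - F\<^sup>2\<close>,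
  \<open>m\<close> for the meridian tangent, \<open>v = X' m + Y' n\<close> for the curve tangent, and \<open>s = q r\<close>. Let \<open>c\<close>
  be \<open>cos \<theta>\<close>, \<open>cosh \<theta>\<close> or \<open>sinh \<theta>\<close>, whichever the angle condition uses, so that
  \<open>c\<^sup>2 = s - p A\<^sup>2\<close> and \<open>B = 2 A c\<close>. Up to sign, the angle condition says
  \<open>\<langle>m,v\<rangle>\<^sup>2 = s e \<langle>v,v\<rangle> c\<^sup>2\<close>. Lagrange's identity \<open>e \<langle>v,v\<rangle> - \<langle>m,v\<rangle>\<^sup>2 = Y'\<^sup>2 \<Delta>\<close> eliminates
  \<open>\<langle>v,v\<rangle>\<close> and turns it into a difference of two squares (\<open>angle_sq_iff\<close>),
  \<open>(\<langle>m,v\<rangle> A)\<^sup>2 = (c R Y')\<^sup>2\<close> with \<open>R = sqrt (p \<Delta>)\<close>.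
  Each of the two roots \<open>\<langle>m,v\<rangle> A = \<plusminus> c R Y'\<close> is linear in \<open>(X', Y')\<close>, because
  \<open>\<langle>m,v\<rangle> = X' e + Y' F\<close>; solving for \<open>Y' / X'\<close> and rationalising the denominator gives the
  stated quotient (\<open>slope_iff\<close>).

  Two points go beyond this algebra. The sign in front of the root has to be the same along the
  whole curve, and in the converse direction so has the sign of \<open>\<langle>m,v\<rangle>\<close>. Both follow from
  connectedness of the parameter interval: two continuous functions with equal squares, one of
  which vanishes everywhere or nowhere, agree up to a global sign
  (\<open>continuous_eq_or_eq_uminus\<close>). When that sign is the wrong one for an angle condition that
  fixes the sign of \<open>\<langle>m,v\<rangle>\<close>, reversing the curve corrects it. Secondly, the angle on a spacelike
  surface is only defined for spacelike tangents; there the other causal types are excluded by the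
  reverse Cauchy--Schwarz inequality.

  All of this holds for any surface whose first fundamental form is continuous along the curve
  (\<open>loxodrome_slope\<close>). For the twisted surface it remains to compute \<open>e = G / 2\<close>, \<open>F = b W\<close>
  and \<open>H = E\<close>.
\<close>

section \<open>Minkowski geometry of a tangent plane\<close>

lemma mink_comm: "mink u v = mink v u"
  by (simp add: mink_def)

lemma mink_linear_right:
  "mink w (x *\<^sub>R u + y *\<^sub>R v) = x * mink w u + y * mink w v"
  by (simp add: mink_def algebra_simps)

lemma mink_uminus_right: "mink u (- v) = - mink u v"
  by (simp add: mink_def)

lemma mink_norm_uminus: "mink_norm (- u) = mink_norm u"
  by (simp add: mink_norm_def mink_def)

lemma mink_norm_sq: "(mink_norm u)\<^sup>2 = \<bar>mink u u\<bar>"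
  by (simp add: mink_norm_def)

lemma causal_sign_pos:
  assumes "causal_sign u s" and "u \<noteq> 0"
  shows "0 < s * mink u u"
  using assms by (auto simp: causal_sign_def spacelike_def timelike_def)

text \<open>A timelike vector lies in no plane on which the form is negative definite. The combination
  \<open>w\<close> of \<open>u\<close> and \<open>v\<close> in the proof has no time component, hence \<open>\<langle>w,w\<rangle> \<ge> 0\<close>, and the Gram
  determinant of \<open>u\<close> and \<open>v\<close> can be read off from \<open>\<langle>u,u\<rangle> \<langle>w,w\<rangle> \<le> 0\<close>.\<close>

lemma timelike_reverse_Cauchy_Schwarz:
  assumes "timelike u"
  shows "mink u u * mink v v \<le> (mink u v)\<^sup>2"
proof -
  define w where "w = u $ 3 *\<^sub>R v - v $ 3 *\<^sub>R u"
  have u: "mink u u < 0" using assms by (simp add: timelike_def)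
  then have u3: "u $ 3 \<noteq> 0"
    by (auto simp: mink_def not_sum_power2_lt_zero simp flip: power2_eq_square)
  have "0 \<le> mink w w"
    by (simp add: mink_def w_def)
  then have "mink u u * mink w w \<le> 0"
    using u by (simp add: mult_nonpos_nonneg)
  moreover have "mink u u * mink w w
      = (u $ 3)\<^sup>2 * (mink u u * mink v v - (mink u v)\<^sup>2)
        + (u $ 3 * mink u v - v $ 3 * mink u u)\<^sup>2"
    by (simp add: mink_def w_def power2_eq_square algebra_simps)
  ultimately have "(u $ 3)\<^sup>2 * (mink u u * mink v v - (mink u v)\<^sup>2) \<le> 0"
    by (smt (verit) zero_le_power2)
  then show ?thesis
    using u3 by (simp add: mult_le_0_iff)
qed

text \<open>Lagrange's identity: replacing \<open>v\<close> by \<open>x u + y v\<close> multiplies the Gram determinant of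
  \<open>u\<close> and \<open>v\<close> by the square \<open>y\<^sup>2\<close> of the determinant of this change of basis.\<close>

lemma Gram_combination:
  "mink u u * mink (x *\<^sub>R u + y *\<^sub>R v) (x *\<^sub>R u + y *\<^sub>R v)
     - (mink u (x *\<^sub>R u + y *\<^sub>R v))\<^sup>2
   = y\<^sup>2 * (mink u u * mink v v - (mink u v)\<^sup>2)"
  by (simp add: mink_def power2_eq_square algebra_simps)

lemma combination_nonzero:
  assumes "mink u u * mink v v - (mink u v)\<^sup>2 \<noteq> 0" and "x \<noteq> 0"
  shows "x *\<^sub>R u + y *\<^sub>R v \<noteq> 0"
proof
  assume z: "x *\<^sub>R u + y *\<^sub>R v = 0"
  have "x\<^sup>2 * (mink v v * mink u u - (mink v u)\<^sup>2) = 0"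
    using Gram_combination[of v y x u] z by (simp add: add.commute mink_def)
  then show False
    using assms by (simp add: mink_comm[of v u] mult.commute)
qed

section \<open>The angle condition\<close>

text \<open>The function of the angle in the angle condition; with it, \<open>A\<close> and \<open>B\<close> obey the same two
  identities for all causal types that admit an angle: \<open>c\<^sup>2 = q r - p A\<^sup>2\<close> and \<open>B = 2 A c\<close>.\<close>

definition lox_C :: "real \<Rightarrow> real \<Rightarrow> real \<Rightarrow> real \<Rightarrow> real" where
  "lox_C p q r \<theta> = (if p = 1 then cos \<theta> else if q * r = 1 then cosh \<theta> else sinh \<theta>)"

lemma lox_C_sq:
  assumes "p \<in> {1, -1}" and "q \<in> {1, -1}" and "r \<in> {1, -1}" and "p = 1 \<longrightarrow> q = 1 \<and> r = 1"
  shows "(lox_C p q r \<theta>)\<^sup>2 = - p * (lox_A p q r \<theta>)\<^sup>2 + q * r"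
  using assms
  by (auto simp: lox_C_def lox_A_def cos_squared_eq cosh_square_eq)

lemma lox_B_eq: "lox_B p q r \<theta> = 2 * lox_A p q r \<theta> * lox_C p q r \<theta>"
  by (simp add: lox_B_def lox_A_def lox_C_def sin_double sinh_double)

lemma lorentz_angle_sq:
  assumes "lorentz_angle p q r m v \<theta>"
  shows "(mink m v)\<^sup>2 = (mink_norm m * mink_norm v * lox_C p q r \<theta>)\<^sup>2"
  using assms unfolding lorentz_angle_def lox_C_def
  by (auto simp: power_mult_distrib)

text \<open>Where the angle condition prescribes the sign of \<open>\<langle>m,v\<rangle>\<close>, this sign is \<open>p\<close>: plus on a
  spacelike surface, minus for two timelike vectors on a timelike one. Where both signs are allowed,
  \<open>p\<close> is one of them, so a single sufficient condition serves all cases.\<close>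

lemma lorentz_angleI:
  assumes "p \<in> {1, -1}" and "q \<in> {1, -1}" and "r \<in> {1, -1}" and "p = 1 \<longrightarrow> q = 1 \<and> r = 1"
    and "admissible_angle p q r \<theta>"
    and "mink m v = p * (mink_norm m * mink_norm v * lox_C p q r \<theta>)"
  shows "lorentz_angle p q r m v \<theta>"
  using assms unfolding lorentz_angle_def lox_C_def by (auto simp: algebra_simps)

section \<open>Solving the angle condition for the slope\<close>

text \<open>With \<open>\<tau> = - p s \<sigma>\<close>, the linear equation on the right reads \<open>y P = x e A\<close> for
  \<open>P = \<tau> c R - F A\<close>. Multiplication by the conjugate \<open>Q = \<tau> c R + F A\<close> removes the root from the
  coefficient of \<open>y\<close>, since \<open>P Q = - p s (F\<^sup>2 - s c\<^sup>2 e H)\<close>; this also shows \<open>Q \<noteq> 0\<close>, so that no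
  solutions are gained.\<close>

lemma slope_iff:
  fixes e F H A c R x y p s \<sigma> :: real
  assumes signs: "p \<in> {1, -1}" "s \<in> {1, -1}" "\<sigma> \<in> {1, -1}"
    and c: "c\<^sup>2 = - p * A\<^sup>2 + s"
    and R: "R\<^sup>2 = p * (e * H - F\<^sup>2)"
    and x: "x \<noteq> 0"
    and den: "F\<^sup>2 - s * c\<^sup>2 * e * H \<noteq> 0"
  shows "y / x = (- p * s * F * A\<^sup>2 * e + \<sigma> * (A * c) * e * R) / (F\<^sup>2 - s * c\<^sup>2 * e * H)
    \<longleftrightarrow> (x * e + y * F) * A = - p * s * \<sigma> * (c * R * y)"
    (is "_ = ?num / ?den \<longleftrightarrow> _")
proof -
  define \<tau> where "\<tau> = - p * s * \<sigma>"
  define P where "P = \<tau> * c * R - F * A"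
  define Q where "Q = \<tau> * c * R + F * A"
  have \<tau>: "\<tau>\<^sup>2 = 1" "\<sigma> = - p * s * \<tau>"
    using signs by (auto simp: \<tau>_def)
  have "P * Q = \<tau>\<^sup>2 * c\<^sup>2 * R\<^sup>2 - F\<^sup>2 * A\<^sup>2"
    by (simp add: P_def Q_def power2_eq_square algebra_simps)
  also have "\<dots> = p * c\<^sup>2 * (e * H) - p * F\<^sup>2 * (c\<^sup>2 + p * A\<^sup>2)"
    unfolding \<tau>(1) R using signs(1) by (auto simp: algebra_simps)
  also have "c\<^sup>2 + p * A\<^sup>2 = s"
    using c by simp
  also have "p * c\<^sup>2 * (e * H) - p * F\<^sup>2 * s = - p * s * ?den"
    using signs(2) by (auto simp: algebra_simps)
  finally have PQ: "P * Q = - p * s * ?den" .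
  then have Q: "Q \<noteq> 0" using den signs by auto
  have den_eq: "?den = - p * s * (P * Q)"
    unfolding PQ using signs by auto
  have num_eq: "?num = - p * s * (e * A * Q)"
    unfolding \<tau>(2) by (simp add: Q_def algebra_simps power2_eq_square)
  have "y / x = ?num / ?den \<longleftrightarrow> y * ?den = ?num * x"
    using x den by (rule frac_eq_eq)
  also have "\<dots> \<longleftrightarrow> y * P * Q = x * e * A * Q"
    unfolding den_eq num_eq using signs by (auto simp: mult_ac)
  also have "\<dots> \<longleftrightarrow> y * P = x * e * A"
    using Q by simp
  also have "\<dots> \<longleftrightarrow> (x * e + y * F) * A = \<tau> * (c * R * y)"
    by (auto simp: P_def algebra_simps)
  finally show ?thesis by (simp only: \<tau>_def)
qed

text \<open>The identity \<open>1 - s c\<^sup>2 = p s A\<^sup>2\<close> is what makes the two conditions equivalent: after \<open>e N\<close>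
  has been eliminated, their differences of squares agree up to the factor \<open>p s = \<plusminus>1\<close>.\<close>

lemma angle_sq_iff:
  fixes N e I A c R y p s \<Delta> :: real
  assumes signs: "p \<in> {1, -1}" "s \<in> {1, -1}"
    and c: "c\<^sup>2 = - p * A\<^sup>2 + s"
    and R: "R\<^sup>2 = p * \<Delta>"
    and Gram: "e * N - I\<^sup>2 = y\<^sup>2 * \<Delta>"
  shows "I\<^sup>2 = s * (e * N) * c\<^sup>2 \<longleftrightarrow> (I * A)\<^sup>2 = (c * R * y)\<^sup>2"
proof -
  have eN: "e * N = I\<^sup>2 + y\<^sup>2 * \<Delta>" using Gram by simp
  have "I\<^sup>2 - s * (e * N) * c\<^sup>2 = I\<^sup>2 * (1 - s * c\<^sup>2) - s * c\<^sup>2 * (y\<^sup>2 * \<Delta>)"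
    unfolding eN by (simp add: algebra_simps)
  also have "1 - s * c\<^sup>2 = p * s * A\<^sup>2"
    unfolding c using signs by auto
  also have "I\<^sup>2 * (p * s * A\<^sup>2) - s * c\<^sup>2 * (y\<^sup>2 * \<Delta>) = p * s * ((I * A)\<^sup>2 - (c * R * y)\<^sup>2)"
    unfolding power_mult_distrib R using signs(1) by (auto simp: algebra_simps)
  finally have "I\<^sup>2 - s * (e * N) * c\<^sup>2 = p * s * ((I * A)\<^sup>2 - (c * R * y)\<^sup>2)" .
  moreover have "p * s \<noteq> 0" using signs by auto
  ultimately show ?thesis by auto
qed

section \<open>Loxodromes on an arbitrary surface\<close>

text \<open>Where \<open>v\<close> has no zero, \<open>u / v\<close> is continuous with values in \<open>{1, -1}\<close>, hence constant on a
  connected set. This is what allows one choice of sign for a whole curve.\<close>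

lemma continuous_eq_or_eq_uminus:
  fixes u v :: "real \<Rightarrow> real"
  assumes "connected J" and "continuous_on J u" and "continuous_on J v"
    and sq: "\<And>t. t \<in> J \<Longrightarrow> (u t)\<^sup>2 = (v t)\<^sup>2"
    and v: "(\<forall>t\<in>J. v t = 0) \<or> (\<forall>t\<in>J. v t \<noteq> 0)"
  shows "\<exists>\<sigma>\<in>{1, -1}. \<forall>t\<in>J. u t = \<sigma> * v t"
proof (cases "\<forall>t\<in>J. v t = 0")
  case True
  then show ?thesis using sq by auto
next
  case False
  then have nz: "v t \<noteq> 0" if "t \<in> J" for t using v that by blast
  have "continuous_on J (\<lambda>t. u t / v t)"
    using assms(2,3) nz by (intro continuous_intros) auto
  then have "connected ((\<lambda>t. u t / v t) ` J)"
    using assms(1) connected_continuous_image by blast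
  moreover have vals: "(\<lambda>t. u t / v t) ` J \<subseteq> {1, -1}"
    using sq nz by (force simp: power2_eq_iff)
  moreover have "finite ((\<lambda>t. u t / v t) ` J)"
    using vals finite_subset by blast
  ultimately obtain \<sigma> where "(\<lambda>t. u t / v t) ` J \<subseteq> {\<sigma>}"
    by (metis connected_finite_iff_sing subset_refl empty_subsetI)
  then have "u t = \<sigma> * v t" if "t \<in> J" for t
    using nz that by (auto simp: field_simps)
  moreover have "\<sigma> \<in> {1, -1}" if "t \<in> J" for t
    using \<open>_ \<subseteq> {\<sigma>}\<close> vals that by auto
  moreover have "\<exists>t. t \<in> J" using False by blast
  ultimately show ?thesis by blast
qed

lemma curve_tangent_reverse:
  assumes "X differentiable at (- t)" and "Y differentiable at (- t)"
  shows "curve_tangent \<Omega> (\<lambda>t. X (- t)) (\<lambda>t. Y (- t)) t = - curve_tangent \<Omega> X Y (- t)"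
proof -
  have "deriv (\<lambda>t. Z (- t)) t = - deriv Z (- t)" if "Z differentiable at (- t)" for Z :: "real \<Rightarrow> real"
  proof -
    have "(Z has_real_derivative deriv Z (- t)) (at (- t))"
      using that by (simp add: DERIV_deriv_iff_real_differentiable)
    then have "((\<lambda>t. Z (- t)) has_real_derivative - deriv Z (- t)) (at t)"
      by (simp add: DERIV_mirror)
    then show ?thesis by (rule DERIV_imp_deriv)
  qed
  then show ?thesis using assms by (simp add: curve_tangent_def)
qed

text \<open>Nondegeneracy of the surface makes both tangents nonzero, so their causal types give
  \<open>r e > 0\<close> and \<open>q \<langle>v,v\<rangle> > 0\<close>, and the product of their norms is a positive continuous function with
  square \<open>q r e \<langle>v,v\<rangle>\<close>. The pointwise equivalences then apply at each parameter, and the sign is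
  made uniform by \<open>continuous_eq_or_eq_uminus\<close>. The regularity of the surface enters only through
  the continuity of its first fundamental form along the curve.\<close>

lemma loxodrome_slope:
  fixes \<Omega> :: "real \<Rightarrow> real \<Rightarrow> real ^ 3" and X Y :: "real \<Rightarrow> real" and p q r \<theta> :: real
  defines "e \<equiv> \<lambda>t. g11 \<Omega> (X t) (Y t)"
    and "F \<equiv> \<lambda>t. g12 \<Omega> (X t) (Y t)"
    and "H \<equiv> \<lambda>t. g22 \<Omega> (X t) (Y t)"
  defines "slope_eq \<equiv> \<lambda>\<sigma> t. deriv Y t / deriv X t =
      (- p * (q * r) * F t * (lox_A p q r \<theta>)\<^sup>2 * e t
         + \<sigma> * (lox_B p q r \<theta> / 2) * e t * sqrt (p * (e t * H t - (F t)\<^sup>2)))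
      / ((F t)\<^sup>2 - (q * r) * (- p * (lox_A p q r \<theta>)\<^sup>2 + q * r) * e t * H t)"
  assumes p: "p \<in> {1, -1}" and q: "q \<in> {1, -1}" and r: "r \<in> {1, -1}"
    and surf: "surface_sign \<Omega> D p" and mer: "meridian_sign \<Omega> D r"
    and J: "is_interval J"
    and X: "X C1_differentiable_on J" and Y: "Y C1_differentiable_on J"
    and D: "\<And>t. t \<in> J \<Longrightarrow> (X t, Y t) \<in> D"
    and cont: "continuous_on J e" "continuous_on J F" "continuous_on J H"
    and curve: "curve_sign \<Omega> X Y J q"
    and adm: "admissible_angle p q r \<theta>"
    and X': "\<And>t. t \<in> J \<Longrightarrow> deriv X t \<noteq> 0"
    and den: "\<And>t. t \<in> J \<Longrightarrow>
      (F t)\<^sup>2 - (q * r) * (- p * (lox_A p q r \<theta>)\<^sup>2 + q * r) * e t * H t \<noteq> 0"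
  shows "loxodrome \<Omega> p q r X Y J \<theta> \<Longrightarrow> \<exists>\<sigma>\<in>{1, -1}. \<forall>t\<in>J. slope_eq \<sigma> t"
    and "\<exists>\<sigma>\<in>{1, -1}. \<forall>t\<in>J. slope_eq \<sigma> t \<Longrightarrow>
      loxodrome \<Omega> p q r X Y J \<theta> \<or>
      loxodrome \<Omega> p q r (\<lambda>t. X (- t)) (\<lambda>t. Y (- t)) (uminus ` J) \<theta>"
proof -
  define A c where "A = lox_A p q r \<theta>" and "c = lox_C p q r \<theta>"
  define R where "R t = sqrt (p * (e t * H t - (F t)\<^sup>2))" for t
  define m where "m t = surf_dx \<Omega> (X t) (Y t)" for t
  define v where "v t = curve_tangent \<Omega> X Y t" for t
  define ip where "ip t = mink (m t) (v t)" for t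
  define len where "len t = mink_norm (m t) * mink_norm (v t)" for t
  have qr: "q * r \<in> {1, -1}" using q r by auto
  have v_def': "v t = deriv X t *\<^sub>R m t + deriv Y t *\<^sub>R surf_dy \<Omega> (X t) (Y t)" for t
    by (simp add: v_def curve_tangent_def m_def)
  have e: "e t = mink (m t) (m t)" and F: "F t = mink (m t) (surf_dy \<Omega> (X t) (Y t))"
    and H: "H t = mink (surf_dy \<Omega> (X t) (Y t)) (surf_dy \<Omega> (X t) (Y t))" for t
    by (simp_all add: e_def F_def H_def g11_def g12_def g22_def m_def)
  have ip_eq: "ip t = deriv X t * e t + deriv Y t * F t" for t
    by (simp add: ip_def v_def' mink_linear_right e F)
  have vv_eq: "mink (v t) (v t) = (deriv X t)\<^sup>2 * e t + 2 * deriv X t * deriv Y t * F t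
      + (deriv Y t)\<^sup>2 * H t" for t
    by (simp add: v_def' e F H mink_def power2_eq_square algebra_simps)
  have Gram: "e t * mink (v t) (v t) - (ip t)\<^sup>2 = (deriv Y t)\<^sup>2 * (e t * H t - (F t)\<^sup>2)" for t
    unfolding ip_def v_def' e F H by (rule Gram_combination)
  have \<Delta>: "0 < p * (e t * H t - (F t)\<^sup>2)" if "t \<in> J" for t
    using surf D[OF that]
    by (auto simp: surface_sign_def spacelike_surface_def timelike_surface_def
        e_def F_def H_def)
  have R_pos: "0 < R t" and R_sq: "(R t)\<^sup>2 = p * (e t * H t - (F t)\<^sup>2)" if "t \<in> J" for t
    using \<Delta>[OF that] by (simp_all add: R_def)
  have \<Delta>0: "mink (m t) (m t) * mink (surf_dy \<Omega> (X t) (Y t)) (surf_dy \<Omega> (X t) (Y t))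
      - (mink (m t) (surf_dy \<Omega> (X t) (Y t)))\<^sup>2 \<noteq> 0" if "t \<in> J" for t
    using \<Delta>[OF that] by (auto simp: e F H)
  have m0: "m t \<noteq> 0" if "t \<in> J" for t
    using \<Delta>0[OF that] by (auto simp: mink_def)
  have v0: "v t \<noteq> 0" if "t \<in> J" for t
    unfolding v_def' by (rule combination_nonzero[OF \<Delta>0[OF that] X'[OF that]])
  have m_causal: "causal_sign (m t) r" if "t \<in> J" for t
    using mer D[OF that] by (auto simp: meridian_sign_def m_def)
  have v_causal: "causal_sign (v t) q" if "t \<in> J" for t
    using curve that by (auto simp: curve_sign_def v_def)
  have re: "0 < r * e t" if "t \<in> J" for t
    using causal_sign_pos[OF m_causal m0] that by (simp add: e)
  have qv: "0 < q * mink (v t) (v t)" if "t \<in> J" for t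
    using causal_sign_pos[OF v_causal v0] that by simp
  have len_pos: "0 < len t" if "t \<in> J" for t
    using re[OF that] qv[OF that] by (auto simp: len_def mink_norm_def e intro!: mult_pos_pos)
  have len_sq: "(len t)\<^sup>2 = q * r * (e t * mink (v t) (v t))" if "t \<in> J" for t
  proof -
    have "\<bar>e t\<bar> = r * e t" using re[OF that] r by auto
    moreover have "\<bar>mink (v t) (v t)\<bar> = q * mink (v t) (v t)" using qv[OF that] q by auto
    ultimately show ?thesis
      by (simp add: len_def power_mult_distrib mink_norm_sq e)
  qed
  \<comment> \<open>The tangent plane of a spacelike surface contains no timelike vector; the curve tangent then
    has the type of the meridian because \<open>e \<langle>v,v\<rangle> \<ge> 0\<close>.\<close>
  have signs: "q = 1 \<and> r = 1" if "p = 1" "t \<in> J" for t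
  proof -
    have ed: "0 < e t * H t - (F t)\<^sup>2" using \<Delta>[OF that(2)] that(1) by simp
    have "r = 1"
    proof (rule ccontr)
      assume "r \<noteq> 1"
      then have "timelike (m t)"
        using m_causal[OF that(2)] by (auto simp: causal_sign_def)
      from timelike_reverse_Cauchy_Schwarz[OF this] ed show False
        by (simp add: e F H not_less[symmetric])
    qed
    moreover have "q = 1"
    proof (rule ccontr)
      assume "q \<noteq> 1"
      then have "mink (v t) (v t) < 0" using qv[OF that(2)] q by auto
      moreover have "0 < e t" using re[OF that(2)] \<open>r = 1\<close> by simp
      ultimately have "e t * mink (v t) (v t) < 0" by (simp add: mult_pos_neg)
      moreover have "0 \<le> (deriv Y t)\<^sup>2 * (e t * H t - (F t)\<^sup>2)" using ed by simp
      ultimately show False using Gram[of t] by (smt (verit) zero_le_power2)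
    qed
    ultimately show ?thesis by simp
  qed
  have c_sq: "c\<^sup>2 = - p * A\<^sup>2 + q * r" if "t \<in> J" for t
    unfolding A_def c_def using lox_C_sq[OF p q r] signs that by blast
  have slope: "slope_eq \<sigma> t \<longleftrightarrow> ip t * A = - p * (q * r) * \<sigma> * (c * R t * deriv Y t)"
    if "t \<in> J" "\<sigma> \<in> {1, -1}" for \<sigma> t
  proof -
    have "lox_B p q r \<theta> / 2 = A * c"
      by (simp add: A_def c_def lox_B_eq)
    then show ?thesis
      unfolding slope_eq_def ip_eq R_def[symmetric] A_def[symmetric]
      using slope_iff[OF p qr that(2) c_sq[OF that(1)] R_sq[OF that(1)] X'[OF that(1)]]
        den[OF that(1), folded A_def] c_sq[OF that(1)] by simp
  qed
  have angle_sq: "(ip t)\<^sup>2 = (len t * c)\<^sup>2 \<longleftrightarrow> (ip t * A)\<^sup>2 = (c * R t * deriv Y t)\<^sup>2"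
    if "t \<in> J" for t
    using angle_sq_iff[OF p qr c_sq[OF that] R_sq[OF that] Gram] len_sq[OF that]
    by (simp add: power_mult_distrib)
  have conn: "connected J" using J by (simp add: is_interval_connected_1)
  have deriv_cont: "continuous_on J (deriv Z)"
    if Z: "Z C1_differentiable_on J" for Z :: "real \<Rightarrow> real"
  proof -
    obtain Z' where Z': "\<forall>t\<in>J. (Z has_vector_derivative Z' t) (at t)" "continuous_on J Z'"
      using Z unfolding C1_differentiable_on_def by blast
    then have "deriv Z t = Z' t" if "t \<in> J" for t
      using that by (auto simp: has_real_derivative_iff_has_vector_derivative[symmetric]
          intro: DERIV_imp_deriv)
    then show ?thesis using Z'(2) continuous_on_cong by metis
  qed
  note conts = cont deriv_cont[OF X] deriv_cont[OF Y]
  have ip_cont: "continuous_on J ip"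
    unfolding ip_eq using conts by (intro continuous_intros)
  have R_cont: "continuous_on J R"
    unfolding R_def using conts by (intro continuous_intros)
  have len_cont: "continuous_on J len"
    unfolding len_def mink_norm_def e[symmetric] vv_eq using conts by (intro continuous_intros)

  show "\<exists>\<sigma>\<in>{1, -1}. \<forall>t\<in>J. slope_eq \<sigma> t" if lox: "loxodrome \<Omega> p q r X Y J \<theta>"
  proof -
    have ip_sq: "(ip t)\<^sup>2 = (len t * c)\<^sup>2" if "t \<in> J" for t
      using lorentz_angle_sq[of p q r "m t" "v t" \<theta>] lox that
      by (simp add: loxodrome_def ip_def len_def c_def m_def v_def)
    have zero_or_nonzero: "(\<forall>t\<in>J. c * R t * deriv Y t = 0) \<or> (\<forall>t\<in>J. c * R t * deriv Y t \<noteq> 0)"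
    \<comment> \<open>\<open>A\<close> and \<open>c\<close> are constant along the curve. If one of them is zero, both sides of
      \<open>\<langle>m,v\<rangle> A = \<plusminus> c R Y'\<close> vanish; otherwise \<open>\<langle>m,v\<rangle>\<close>, being \<open>\<plusminus> c\<close> times a positive length, has no
      zero, and therefore neither has \<open>Y'\<close>.\<close>
    proof (cases "A = 0 \<or> c = 0")
      case True
      then have "(c * R t * deriv Y t)\<^sup>2 = 0" if "t \<in> J" for t
        using angle_sq[OF that] ip_sq[OF that] by fastforce
      then show ?thesis by (simp only: zero_eq_power2) blast
    next
      case False
      have "c * R t * deriv Y t \<noteq> 0" if "t \<in> J" for t
      proof -
        have "ip t \<noteq> 0" using ip_sq[OF that] len_pos[OF that] False by auto
        then show ?thesis using angle_sq[OF that] ip_sq[OF that] False by auto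
      qed
      then show ?thesis by blast
    qed
    have "\<exists>\<tau>\<in>{1, -1}. \<forall>t\<in>J. ip t * A = \<tau> * (c * R t * deriv Y t)"
    proof (rule continuous_eq_or_eq_uminus[OF conn _ _ _ zero_or_nonzero])
      show "continuous_on J (\<lambda>t. ip t * A)" "continuous_on J (\<lambda>t. c * R t * deriv Y t)"
        using ip_cont R_cont conts(5) by (auto intro!: continuous_intros)
      show "(ip t * A)\<^sup>2 = (c * R t * deriv Y t)\<^sup>2" if "t \<in> J" for t
        using angle_sq[OF that] ip_sq[OF that] by blast
    qed
    then obtain \<tau> where \<tau>: "\<tau> \<in> {1, -1}" "\<forall>t\<in>J. ip t * A = \<tau> * (c * R t * deriv Y t)"
      by blast
    define \<sigma> where "\<sigma> = - p * (q * r) * \<tau>"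
    have "\<sigma> \<in> {1, -1}" using \<tau>(1) p q r by (auto simp: \<sigma>_def)
    moreover have "- p * (q * r) * \<sigma> = \<tau>" using p qr by (auto simp: \<sigma>_def)
    ultimately show ?thesis using slope \<tau>(2) by metis
  qed

  show "loxodrome \<Omega> p q r X Y J \<theta> \<or>
      loxodrome \<Omega> p q r (\<lambda>t. X (- t)) (\<lambda>t. Y (- t)) (uminus ` J) \<theta>"
    if eq: "\<exists>\<sigma>\<in>{1, -1}. \<forall>t\<in>J. slope_eq \<sigma> t"
  proof -
    obtain \<sigma> where \<sigma>: "\<sigma> \<in> {1, -1}" "\<forall>t\<in>J. slope_eq \<sigma> t" using eq by blast
    have ip_sq: "(ip t)\<^sup>2 = (len t * c)\<^sup>2" if "t \<in> J" for t
    proof -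
      have "ip t * A = - p * (q * r) * \<sigma> * (c * R t * deriv Y t)"
        using slope \<sigma> that by blast
      moreover have "- p * (q * r) * \<sigma> \<in> {1, -1}"
        using p qr \<sigma>(1) by auto
      ultimately have "(ip t * A)\<^sup>2 = (c * R t * deriv Y t)\<^sup>2"
        by auto
      then show ?thesis using angle_sq[OF that] by simp
    qed
    have zero_or_nonzero: "(\<forall>t\<in>J. len t * c = 0) \<or> (\<forall>t\<in>J. len t * c \<noteq> 0)"
      using len_pos by fastforce
    have "continuous_on J (\<lambda>t. len t * c)"
      using len_cont by (intro continuous_intros)
    then obtain \<tau> where \<tau>: "\<tau> \<in> {1, -1}" "\<forall>t\<in>J. ip t = \<tau> * (len t * c)"
      using continuous_eq_or_eq_uminus[OF conn ip_cont _ ip_sq zero_or_nonzero] by blast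
    have angleI: "lorentz_angle p q r (m t) w \<theta>"
      if "t \<in> J" "mink (m t) w = p * (mink_norm (m t) * mink_norm w * c)" for t w
      using lorentz_angleI[OF p q r _ adm] signs that by (auto simp: c_def)
    \<comment> \<open>\<open>p\<close> is the sign that fits every form of the angle condition; reversing the curve changes
      the sign of \<open>\<langle>m,v\<rangle>\<close> and leaves the lengths unchanged.\<close>
    consider "\<tau> = p" | "\<tau> = - p" using \<tau>(1) p by auto
    then show ?thesis
    proof cases
      case 1
      then have "loxodrome \<Omega> p q r X Y J \<theta>"
        using \<tau>(2) angleI
        by (simp add: loxodrome_def ip_def len_def m_def v_def)
      then show ?thesis ..
    next
      case 2
      have "lorentz_angle p q r (surf_dx \<Omega> (X t) (Y t))
          (curve_tangent \<Omega> (\<lambda>t. X (- t)) (\<lambda>t. Y (- t)) (- t)) \<theta>" if "t \<in> J" for t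
      proof -
        have "X differentiable at t" "Y differentiable at t"
          using X Y that by (auto simp: C1_differentiable_on_eq)
        then have "curve_tangent \<Omega> (\<lambda>t. X (- t)) (\<lambda>t. Y (- t)) (- t) = - v t"
          using curve_tangent_reverse[of X "- t" Y] by (simp add: v_def)
        moreover have "lorentz_angle p q r (m t) (- v t) \<theta>"
          using \<tau>(2) 2 that
          by (intro angleI) (auto simp: mink_uminus_right mink_norm_uminus ip_def len_def)
        ultimately show ?thesis by (simp add: m_def)
      qed
      then have "loxodrome \<Omega> p q r (\<lambda>t. X (- t)) (\<lambda>t. Y (- t)) (uminus ` J) \<theta>"
        by (simp add: loxodrome_def)
      then show ?thesis ..
    qed
  qed
qed

section \<open>The first fundamental form of a twisted surface\<close>

lemma has_vector_derivative_vector_3: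
  fixes u v w :: "real \<Rightarrow> real"
  assumes "(u has_real_derivative u') (at x)" "(v has_real_derivative v') (at x)"
    "(w has_real_derivative w') (at x)"
  shows "((\<lambda>s. vector [u s, v s, w s] :: real ^ 3) has_vector_derivative vector [u', v', w']) (at x)"
proof -
  have vec: "(vector [x, y, z] :: real ^ 3) = x *\<^sub>R axis 1 1 + y *\<^sub>R axis 2 1 + z *\<^sub>R axis 3 1"
    for x y z :: real
    by (simp add: vec_eq_iff forall_3 axis_def)
  show ?thesis
    unfolding vec using assms by (auto intro!: derivative_eq_intros)
qed

lemma twisted_surf_dx:
  fixes a b x y :: real and f g :: "real \<Rightarrow> real"
  defines "\<rho> \<equiv> a + f y * cosh (b * x) + g y * sinh (b * x)"
    and "z \<equiv> f y * sinh (b * x) + g y * cosh (b * x)"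
  shows "surf_dx (twisted_surface a b f g) x y = vector
    [b * z * cos x - \<rho> * sin x, b * z * sin x + \<rho> * cos x, b * (\<rho> - a)]"
  unfolding surf_dx_def twisted_surface_def \<rho>_def z_def
  by (intro vector_derivative_at has_vector_derivative_vector_3)
     (auto intro!: derivative_eq_intros simp: algebra_simps)

lemma twisted_surf_dy:
  fixes a b x y :: real and f g :: "real \<Rightarrow> real"
  assumes "f field_differentiable at y" and "g field_differentiable at y"
  defines "\<rho>' \<equiv> deriv f y * cosh (b * x) + deriv g y * sinh (b * x)"
  shows "surf_dy (twisted_surface a b f g) x y = vector
    [\<rho>' * cos x, \<rho>' * sin x, deriv f y * sinh (b * x) + deriv g y * cosh (b * x)]"
proof -
  have "(f has_real_derivative deriv f y) (at y)" "(g has_real_derivative deriv g y) (at y)"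
    using assms by (simp_all add: field_differentiable_derivI)
  then show ?thesis
    unfolding surf_dy_def twisted_surface_def \<rho>'_def
    by (intro vector_derivative_at has_vector_derivative_vector_3)
       (auto intro!: derivative_eq_intros simp: algebra_simps)
qed

text \<open>The tangents are best written in the frame rotated by \<open>x\<close> about the time axis; being an
  isometry, this rotation removes \<open>x\<close> from all inner products except for the hyperbolic
  functions of \<open>b x\<close>.\<close>

lemma rotated_frame_mink:
  "mink (vector [u * cos x - v * sin x, u * sin x + v * cos x, w])
        (vector [u' * cos x - v' * sin x, u' * sin x + v' * cos x, w'])
   = u * u' + v * v' - w * w'"
proof -
  have "(u * c - v * s) * (u' * c - v' * s) + (u * s + v * c) * (u' * s + v' * c)
      = (u * u' + v * v') * (s\<^sup>2 + c\<^sup>2)" for c s :: real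
    by (simp add: power2_eq_square algebra_simps)
  then show ?thesis by (simp add: mink_def)
qed

lemma twisted_g11:
  "2 * g11 (twisted_surface a b f g) x y = twisted_G a b f g x y"
proof -
  define C S where "C = cosh (b * x)" and "S = sinh (b * x)"
  have CS: "C\<^sup>2 = S\<^sup>2 + 1" by (simp add: C_def S_def cosh_square_eq)
  have dbl: "cosh (2 * b * x) = 2 * S\<^sup>2 + 1"
    using cosh_double[of "b * x"] CS by (simp add: C_def S_def mult.assoc)
  have "2 * g11 (twisted_surface a b f g) x y
      = 2 * (a + f y * C + g y * S)\<^sup>2
        + 2 * b\<^sup>2 * ((f y * S + g y * C)\<^sup>2 - (f y * C + g y * S)\<^sup>2)"
    unfolding g11_def twisted_surf_dx rotated_frame_mink C_def S_def
    by (simp add: power2_eq_square algebra_simps)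
  also have "\<dots> = 2 * a\<^sup>2 + 2 * (f y)\<^sup>2 * C\<^sup>2 + 2 * (g y)\<^sup>2 * S\<^sup>2
        + 4 * a * f y * C + 4 * a * g y * S + 4 * f y * g y * C * S
        + 2 * b\<^sup>2 * ((g y)\<^sup>2 - (f y)\<^sup>2) * (C\<^sup>2 - S\<^sup>2)"
    by (simp add: power2_eq_square algebra_simps)
  also have "\<dots> = twisted_G a b f g x y"
    unfolding twisted_G_def dbl C_def[symmetric] S_def[symmetric] CS
    by (simp add: algebra_simps)
  finally show ?thesis .
qed

lemma twisted_g12:
  assumes "f field_differentiable at y" and "g field_differentiable at y"
  shows "g12 (twisted_surface a b f g) x y = b * twisted_W f g y"
proof -
  define C S where "C = cosh (b * x)" and "S = sinh (b * x)"
  have CS: "C\<^sup>2 = S\<^sup>2 + 1" by (simp add: C_def S_def cosh_square_eq)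
  have "g12 (twisted_surface a b f g) x y
      = b * (f y * S + g y * C) * (deriv f y * C + deriv g y * S)
        - b * (f y * C + g y * S) * (deriv f y * S + deriv g y * C)"
    unfolding g12_def twisted_surf_dx twisted_surf_dy[OF assms]
    using rotated_frame_mink[where v' = 0] by (simp add: C_def S_def)
  also have "\<dots> = b * twisted_W f g y * (C\<^sup>2 - S\<^sup>2)"
    by (simp add: twisted_W_def power2_eq_square algebra_simps)
  finally show ?thesis using CS by simp
qed

lemma twisted_g22:
  assumes "f field_differentiable at y" and "g field_differentiable at y"
  shows "g22 (twisted_surface a b f g) x y = twisted_E f g y"
proof -
  define C S where "C = cosh (b * x)" and "S = sinh (b * x)"
  have CS: "C\<^sup>2 = S\<^sup>2 + 1" by (simp add: C_def S_def cosh_square_eq)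
  have "g22 (twisted_surface a b f g) x y
      = (deriv f y * C + deriv g y * S)\<^sup>2 - (deriv f y * S + deriv g y * C)\<^sup>2"
    unfolding g22_def twisted_surf_dy[OF assms]
    using rotated_frame_mink[where v = 0 and v' = 0]
    by (simp add: C_def S_def power2_eq_square)
  also have "\<dots> = twisted_E f g y * (C\<^sup>2 - S\<^sup>2)"
    by (simp add: twisted_E_def power2_eq_square algebra_simps)
  finally show ?thesis using CS by simp
qed

section \<open>Loxodromes on twisted surfaces\<close>

theorem theorem2:
  fixes a b p q r \<theta> :: real
    and f g X Y :: "real \<Rightarrow> real"
    and I J :: "real set"
    and D :: "(real \<times> real) set"
  assumes "open I" and "is_interval I"
    and "smooth_fun_on f I" and "smooth_fun_on g I"
    and "open D" and "D \<subseteq> UNIV \<times> I"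
    and "p \<in> {1, -1}" and "q \<in> {1, -1}" and "r \<in> {1, -1}"
    and "surface_sign (twisted_surface a b f g) D p"
    and "meridian_sign (twisted_surface a b f g) D r"
    and "open J" and "is_interval J"
    and "X C1_differentiable_on J" and "Y C1_differentiable_on J"
    and "\<And>t. t \<in> J \<Longrightarrow> (X t, Y t) \<in> D"
    and "curve_sign (twisted_surface a b f g) X Y J q"
    and "admissible_angle p q r \<theta>"
    and "\<And>t. t \<in> J \<Longrightarrow> deriv X t \<noteq> 0"
    and "\<And>t. t \<in> J \<Longrightarrow> lox_den a b f g p q r \<theta> (X t) (Y t) \<noteq> 0"
  shows "(loxodrome (twisted_surface a b f g) p q r X Y J \<theta> \<longrightarrow>
           (\<exists>\<sigma>\<in>{1, -1}. \<forall>t\<in>J. deriv Y t / deriv X t =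
              lox_num a b f g p q r \<theta> \<sigma> (X t) (Y t) / lox_den a b f g p q r \<theta> (X t) (Y t)))
       \<and> ((\<exists>\<sigma>\<in>{1, -1}. \<forall>t\<in>J. deriv Y t / deriv X t =
              lox_num a b f g p q r \<theta> \<sigma> (X t) (Y t) / lox_den a b f g p q r \<theta> (X t) (Y t)) \<longrightarrow>
           loxodrome (twisted_surface a b f g) p q r X Y J \<theta> \<or>
           loxodrome (twisted_surface a b f g) p q r (\<lambda>t. X (- t)) (\<lambda>t. Y (- t)) (uminus ` J) \<theta>)"
proof -
  let ?\<Omega> = "twisted_surface a b f g"
  let ?A = "lox_A p q r \<theta>" and ?C = "lox_C p q r \<theta>"
  have YI: "Y t \<in> I" if "t \<in> J" for t
    using assms(6,16) that by blast
  have diff: "f field_differentiable at y" "g field_differentiable at y"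
    "deriv f field_differentiable at y" "deriv g field_differentiable at y" if "y \<in> I" for y
  proof -
    have "(deriv ^^ n) f field_differentiable at y" "(deriv ^^ n) g field_differentiable at y" for n
      using assms(3,4) that by (auto simp: smooth_fun_on_def)
    from this[of 0] this[of 1]
    show "f field_differentiable at y" "g field_differentiable at y"
      "deriv f field_differentiable at y" "deriv g field_differentiable at y" by simp_all
  qed
  have g11: "g11 ?\<Omega> x y = twisted_G a b f g x y / 2" for x y
    using twisted_g11[of a b f g x y] by simp
  have g12: "g12 ?\<Omega> (X t) (Y t) = b * twisted_W f g (Y t)" if "t \<in> J" for t
    by (rule twisted_g12) (use diff YI that in auto)
  have g22: "g22 ?\<Omega> (X t) (Y t) = twisted_E f g (Y t)" if "t \<in> J" for t
    by (rule twisted_g22) (use diff YI that in auto)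
  have cont_XY: "continuous_on J X" "continuous_on J Y"
    using assms(14,15) by (auto simp: C1_differentiable_imp_continuous_on)
  have cont_Y: "continuous_on J (\<lambda>t. h (Y t))"
    if "\<And>y. y \<in> I \<Longrightarrow> h field_differentiable at y" for h :: "real \<Rightarrow> real"
  proof -
    have "continuous_on I h"
      using that by (simp add: continuous_at_imp_continuous_on field_differentiable_imp_continuous_at)
    then show ?thesis
      using cont_XY(2) YI by (auto intro: continuous_on_compose2)
  qed
  note cont_fg = cont_XY cont_Y[of f] cont_Y[of g] cont_Y[of "deriv f"] cont_Y[of "deriv g"]
  have cont11: "continuous_on J (\<lambda>t. g11 ?\<Omega> (X t) (Y t))"
    unfolding g11 twisted_G_def using cont_fg diff by (intro continuous_intros) auto
  have "continuous_on J (\<lambda>t. b * twisted_W f g (Y t))"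
    unfolding twisted_W_def using cont_fg diff by (intro continuous_intros) auto
  then have cont12: "continuous_on J (\<lambda>t. g12 ?\<Omega> (X t) (Y t))"
    using g12 continuous_on_cong by (metis (no_types, lifting))
  have "continuous_on J (\<lambda>t. twisted_E f g (Y t))"
    unfolding twisted_E_def using cont_fg diff by (intro continuous_intros) auto
  then have cont22: "continuous_on J (\<lambda>t. g22 ?\<Omega> (X t) (Y t))"
    using g22 continuous_on_cong by (metis (no_types, lifting))
  \<comment> \<open>The quotient for a general surface in terms of \<open>g11\<close>, \<open>g12\<close>, \<open>g22\<close>; since \<open>G\<close> is twice \<open>g11\<close>,
    \<open>lox_num\<close> and \<open>lox_den\<close> are both its terms doubled.\<close>
  define num den where "num \<sigma> t = - p * (q * r) * g12 ?\<Omega> (X t) (Y t) * ?A\<^sup>2 * g11 ?\<Omega> (X t) (Y t)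
      + \<sigma> * (lox_B p q r \<theta> / 2) * g11 ?\<Omega> (X t) (Y t)
        * sqrt (p * (g11 ?\<Omega> (X t) (Y t) * g22 ?\<Omega> (X t) (Y t) - (g12 ?\<Omega> (X t) (Y t))\<^sup>2))"
    and "den t = (g12 ?\<Omega> (X t) (Y t))\<^sup>2
      - (q * r) * (- p * ?A\<^sup>2 + q * r) * g11 ?\<Omega> (X t) (Y t) * g22 ?\<Omega> (X t) (Y t)" for \<sigma> t
  have num: "lox_num a b f g p q r \<theta> \<sigma> (X t) (Y t) = 2 * num \<sigma> t" if "t \<in> J" for \<sigma> t
  proof -
    have "- p * (2 * b\<^sup>2 * (twisted_W f g (Y t))\<^sup>2
          - twisted_E f g (Y t) * twisted_G a b f g (X t) (Y t)) / 2
        = p * (twisted_G a b f g (X t) (Y t) / 2 * twisted_E f g (Y t)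
          - (b * twisted_W f g (Y t))\<^sup>2)"
      by (simp add: power_mult_distrib field_simps)
    then show ?thesis
      unfolding lox_num_def num_def g11 g12[OF that] g22[OF that] by (simp add: algebra_simps)
  qed
  have den: "lox_den a b f g p q r \<theta> (X t) (Y t) = 2 * den t" if "t \<in> J" for t
    unfolding lox_den_def den_def g11 g12[OF that] g22[OF that]
    by (simp add: power_mult_distrib algebra_simps)
  have den0: "den t \<noteq> 0" if "t \<in> J" for t
    using assms(20)[OF that] den[OF that] by simp
  note equations = loxodrome_slope[OF assms(7-11) assms(13-16) cont11 cont12 cont22 assms(17-19)
      den0[unfolded den_def], folded num_def den_def]
  show ?thesis
    using equations by (simp add: num den)
qed

end
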